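(* Suppose that $\{U_j^n\mid 1\le j\le J-1,\ 1\le n\le N\}$ is the solution of the implicit difference scheme $$\delta_tU_j^{1/2}+\nabla U_j^1\,\Delta_xU_j^1=I^{(\alpha)}\delta_x^2U_j^{1/2}+f_j^{1/2},\qquad 1\le j\le J-1,$$ $$\delta_tU_j^{n-1/2}+\nabla U_j^{n-1/2}\,\Delta_xU_j^{n-1/2}=I^{(\alpha)}\delta_x^2U_j^{n-1/2}+f_j^{n-1/2},\qquad 1\le j\le J-1,\ 2\le n\le N,$$ $$U_j^0=u_0(x_j),\quad 1\le j\le J-1,\qquad U_0^n=U_J^n=0,\quad 1\le n\le N.$$ Then for $1\le n\le N$, $$\|U^n\|\le\|U^0\|+2\sum_{l=1}^{n}k_l\|f^{l-1/2}\|.$$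
   Context: Fix $L,T>0$, $0<\alpha<1$, a function $u_0:[0,L]\to\mathbb{R}$, and the kernel $\beta(t)=t^{\alpha-1}/\Gamma(\alpha)$. Grids: $J,N\in\mathbb{Z}^+$, $h=L/J$, $x_j=jh$ ($0\le j\le J$); temporal levels $0=t_0<t_1<\dots<t_N=T$, $k_n=t_n-t_{n-1}$. Time operators, for a sequence $W^0,\dots,W^N$: $\delta_tW^{n-1/2}=\frac{1}{k_n}(W^n-W^{n-1})$ and $W^{n-1/2}=\frac12(W^n+W^{n-1})$ for $n\ge1$. The discrete fractional integral is $$I^{(\alpha)}W^{n-1/2}=\widehat w_{n1}W^1k_1+\sum_{s=2}^{n}\widehat w_{ns}W^{s-1/2}k_s,\qquad \widehat w_{ns}=\frac{1}{k_nk_s}\int_{t_{n-1}}^{t_n}\int_{t_{s-1}}^{\min\{t,t_s\}}\beta(t-\zeta)\,d\zeta\,dt$$ (so $I^{(\alpha)}W^{1/2}=\widehat w_{11}W^1k_1$); $I^{(\alpha)}\delta_x^2U_j^{n-1/2}$ means this expression with $W^m=\delta_x^2U_j^m$. Space operators, for $W=(W_0,\dots,W_J)$ and $1\le j\le J-1$: $\Delta_xW_j=\frac{1}{2h}(W_{j+1}-W_{j-1})$, $\delta_x^2W_j=\frac{1}{h^2}(W_{j+1}-2W_j+W_{j-1})$, $\nabla W_j=\frac13(W_{j-1}+W_j+W_{j+1})$. The products $\nabla U_j\,\Delta_xU_j$ are pointwise. The numbers $f_j^{n-1/2}$ are given real data (approximations of $\frac1{k_n}\int_{t_{n-1}}^{t_n}f(x_j,t)\,dt$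 for a source term $f$, for instance $\frac12(f(x_j,t_n)+f(x_j,t_{n-1}))$). Norm of a grid function: $\|w\|=\big(h\sum_{s=1}^{J-1}w_s^2\big)^{1/2}$. *)

theory Defs
  imports "HOL-Analysis.Analysis"
begin

text \<open>
  A quantity carrying the half-integer time index \<open>n - 1/2\<close> (with \<open>n \<ge> 1\<close>) is indexed
  by the natural number \<open>n\<close>. Time sequences \<open>W\<close> and grid functions \<open>w\<close> are total
  functions on \<open>nat\<close>; the time operators are meant for \<open>n \<ge> 1\<close> and the space
  operators for \<open>1 \<le> j \<le> J - 1\<close>, so that the truncated subtraction on \<open>nat\<close> is exact.
\<close>

definition frac_kernel :: "real \<Rightarrow> real \<Rightarrow> real" where
  "frac_kernel \<alpha> t = t powr (\<alpha> - 1) / Gamma \<alpha>"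

definition time_step :: "(nat \<Rightarrow> real) \<Rightarrow> nat \<Rightarrow> real" where
  "time_step t n = t n - t (n - 1)"

definition delta_t :: "(nat \<Rightarrow> real) \<Rightarrow> (nat \<Rightarrow> real) \<Rightarrow> nat \<Rightarrow> real" where
  "delta_t t W n = (W n - W (n - 1)) / time_step t n"

definition half_level :: "(nat \<Rightarrow> real) \<Rightarrow> nat \<Rightarrow> real" where
  "half_level W n = (W n + W (n - 1)) / 2"

text \<open>
  For \<open>s = n\<close> the inner integrand is singular at \<open>\<zeta> = \<tau>\<close>, but integrable; the value
  \<open>frac_kernel \<alpha> 0 = 0\<close> is irrelevant.
\<close>

definition frac_weight :: "real \<Rightarrow> (nat \<Rightarrow> real) \<Rightarrow> nat \<Rightarrow> nat \<Rightarrow> real" where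
  "frac_weight \<alpha> t n s =
     1 / (time_step t n * time_step t s) *
     integral {t (n - 1)..t n}
       (\<lambda>\<tau>. integral {t (s - 1)..min \<tau> (t s)} (\<lambda>\<zeta>. frac_kernel \<alpha> (\<tau> - \<zeta>)))"

definition frac_integral :: "real \<Rightarrow> (nat \<Rightarrow> real) \<Rightarrow> (nat \<Rightarrow> real) \<Rightarrow> nat \<Rightarrow> real" where
  "frac_integral \<alpha> t W n =
     frac_weight \<alpha> t n 1 * W 1 * time_step t 1 +
     (\<Sum>s = 2..n. frac_weight \<alpha> t n s * half_level W s * time_step t s)"

definition Delta_x :: "real \<Rightarrow> (nat \<Rightarrow> real) \<Rightarrow> nat \<Rightarrow> real" where
  "Delta_x h w j = (w (j + 1) - w (j - 1)) / (2 * h)"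

definition delta_x2 :: "real \<Rightarrow> (nat \<Rightarrow> real) \<Rightarrow> nat \<Rightarrow> real" where
  "delta_x2 h w j = (w (j + 1) - 2 * w j + w (j - 1)) / h\<^sup>2"

definition nabla :: "(nat \<Rightarrow> real) \<Rightarrow> nat \<Rightarrow> real" where
  "nabla w j = (w (j - 1) + w j + w (j + 1)) / 3"

definition grid_norm :: "real \<Rightarrow> nat \<Rightarrow> (nat \<Rightarrow> real) \<Rightarrow> real" where
  "grid_norm h J w = sqrt (h * (\<Sum>s = 1..J - 1. (w s)\<^sup>2))"

end

theory Submission
  imports Defs
begin

text \<open>
  The proof is an energy estimate. Let \<open>V 1 = U 1\<close> and, for later \<open>n\<close>, let \<open>V n\<close> be the midpoint of \<open>U n\<close>
  and \<open>U (n - 1)\<close>. Multiply the scheme at step \<open>n\<close> by \<open>time_step t n * V n j\<close> and sum over \<open>j\<close>.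
  The time difference yields at least half of the increment of the squared norm
  (\<open>increment_times_test_level\<close>). The convection term is in conservation form and sums to zero because \<open>V n\<close>
  vanishes at both ends (\<open>convection_orthogonal\<close>). The memory term, once all steps are added, is
  nonpositive (\<open>memory_term_dissipative\<close>). By the Cauchy-Schwarz inequality the squared norm of \<open>U m\<close>
  exceeds that of \<open>U 0\<close> by at most twice the sum of \<open>time_step t l\<close> times the norms of \<open>f l\<close> and \<open>V l\<close>.
  Applying this at the level of largest norm and cancelling one factor gives the linear bound
  (\<open>linear_bound_of_energy_inequality\<close>).

  The substance lies in the sign of the memory term, on an arbitrary time mesh. Summation by parts in
  space reduces it to the nonnegativity of the causal quadratic form with coefficients
  \<open>time_step t n * frac_weight \<alpha> t n s * time_step t s\<close>, \<open>s \<le> n\<close>. These numbers are double integrals of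
  the kernel, hence second differences of \<open>x powr (1 + \<alpha>)\<close>; up to a positive constant they are the
  covariances of the increments of fractional Brownian motion with Hurst index \<open>(1 + \<alpha>) / 2\<close> over the time
  steps, with the diagonal halved. So the causal form is a positive multiple of a symmetric form given
  by a covariance matrix. That matrix is shown to be nonnegative by the representation of \<open>\<bar>x\<bar> powr p\<close>, for
  \<open>0 < p < 2\<close>, as a positive multiple of the integral of \<open>(1 - cos (x * u)) * u powr (- 1 - p)\<close> over
  \<open>u > 0\<close>, which exhibits it as an integral of Gram matrices (\<open>increment_kernel_nonneg_definite\<close>).
\<close>

section \<open>Cosine representation of powers\<close>

lemma one_minus_cos_le: "1 - cos (x::real) \<le> x\<^sup>2 / 2"
proof -
  have "\<bar>sin (x/2)\<bar> \<le> \<bar>x/2\<bar>" by (rule abs_sin_x_le_abs_x)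
  then have "(sin (x/2))\<^sup>2 \<le> (x/2)\<^sup>2" by (simp only: abs_le_square_iff)
  moreover have "cos x = 1 - 2 * (sin (x/2))\<^sup>2" using cos_double_sin[of "x/2"] by simp
  ultimately show ?thesis by (simp add: power_divide)
qed

definition cos_density :: "real \<Rightarrow> real \<Rightarrow> real \<Rightarrow> real" where
  "cos_density p x u = indicator {0<..} u * (u powr (- 1 - p) * (1 - cos (x * u)))"

lemma cos_density_measurable [measurable]: "cos_density p x \<in> borel_measurable borel"
  unfolding cos_density_def by measurable

lemma cos_density_nonneg: "0 \<le> cos_density p x u"
  by (simp add: cos_density_def)

text \<open>
  Near \<open>0\<close> the integrand is of order \<open>u powr (1 - p)\<close>, integrable because \<open>p < 2\<close>; at infinity it is
  at most \<open>2 * u powr (- 1 - p)\<close>, integrable because \<open>0 < p\<close>.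
\<close>

lemma cos_density_integrable_1:
  assumes "0 < p" "p < 2"
  shows "integrable lborel (cos_density p 1)"
proof -
  let ?g = "\<lambda>u::real. (if u \<in> {0..1} then u powr (1 - p) else 0)
                  + 2 * (if u \<in> {1..} then u powr (- 1 - p) else 0)"
  have "(\<lambda>u. u powr (1 - p)) integrable_on {0..1::real}"
    using has_integral_powr_from_0[of "1 - p" 1] assms by (auto simp: integrable_on_def)
  moreover have "(\<lambda>u. u powr (- 1 - p)) integrable_on {1::real..}"
    using has_integral_powr_to_inf[of "- 1 - p" 1] assms by (auto simp: integrable_on_def)
  ultimately have "?g integrable_on UNIV"
    by (intro integrable_add integrable_on_mult_right) (simp_all only: integrable_restrict_UNIV)
  moreover have "norm (cos_density p 1 u) \<le> ?g u" for u
  proof -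
    consider "u \<le> 0" | "0 < u" "u \<le> 1" | "1 < u" by linarith
    then show ?thesis
    proof cases
      case 2
      have "u powr (- 1 - p) * (1 - cos u) \<le> u powr (- 1 - p) * u\<^sup>2"
        using one_minus_cos_le[of u] zero_le_power2[of u] by (intro mult_left_mono) (linarith, simp)
      also have "\<dots> = u powr (1 - p)"
        using 2 powr_add[of u "- 1 - p" 2] by (simp add: algebra_simps)
      also have "\<dots> \<le> ?g u" using 2 by simp
      finally show ?thesis using 2 cos_density_nonneg[of p 1 u] by (simp add: cos_density_def)
    next
      case 3
      have "u powr (- 1 - p) * (1 - cos u) \<le> u powr (- 1 - p) * 2"
        using cos_ge_minus_one[of u] by (intro mult_left_mono) (linarith, simp)
      then show ?thesis using 3 cos_density_nonneg[of p 1 u] by (simp add: cos_density_def)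
    qed (auto simp: cos_density_def)
  qed
  ultimately have "cos_density p 1 absolutely_integrable_on UNIV"
    by (intro measurable_bounded_by_integrable_imp_absolutely_integrable[where g = ?g])
       (auto simp: lebesgue_on_UNIV_eq intro: measurable_completion)
  then show ?thesis
    by (simp add: set_integrable_def integrable_completion)
qed

lemma cos_density_scale:
  assumes "x \<noteq> 0"
  shows "cos_density p x u = \<bar>x\<bar> powr (1 + p) * cos_density p 1 (0 + \<bar>x\<bar> * u)"
proof (cases "u > 0")
  case True
  have "cos (\<bar>x\<bar> * u) = cos (x * u)" by (cases "x \<ge> 0") auto
  then show ?thesis using True assms
    by (simp add: cos_density_def powr_mult powr_diff powr_minus powr_add zero_less_mult_iff field_simps)
next
  case False
  then have "\<not> 0 < \<bar>x\<bar> * u" by (simp add: zero_less_mult_iff)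
  with False show ?thesis by (simp add: cos_density_def)
qed

text \<open>
  The substitution \<open>v = \<bar>x\<bar> * u\<close> extracts the factor \<open>\<bar>x\<bar> powr p\<close>. This writes the power
  function as a superposition of the functions \<open>1 - cos (x * u)\<close>, whose second
  differences are explicit Gram matrices.
\<close>

lemma cos_density_integral:
  assumes "0 < p" "p < 2"
  shows "has_bochner_integral lborel (cos_density p x) (\<bar>x\<bar> powr p * integral\<^sup>L lborel (cos_density p 1))"
proof (cases "x = 0")
  case True
  then have "cos_density p x = (\<lambda>u. 0)" by (auto simp: cos_density_def)
  with True show ?thesis by (simp add: has_bochner_integral_zero)
next
  case False
  have eq: "cos_density p x = (\<lambda>u. \<bar>x\<bar> powr (1 + p) * cos_density p 1 (0 + \<bar>x\<bar> * u))"
    using cos_density_scale[OF False] by auto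
  have "integrable lborel (cos_density p x)"
    unfolding eq
    by (intro integrable_mult_right lborel_integrable_real_affine cos_density_integrable_1 assms)
       (use False in auto)
  moreover have "integral\<^sup>L lborel (cos_density p x) = \<bar>x\<bar> powr p * integral\<^sup>L lborel (cos_density p 1)"
    unfolding eq using False lborel_integral_real_affine[of "\<bar>x\<bar>" "cos_density p 1" 0]
    by (simp add: powr_add)
  ultimately show ?thesis by (simp add: has_bochner_integral_iff)
qed

text \<open>
  The interval \<open>{1..2}\<close> alone contributes a positive amount: cosine decreases up to \<open>pi\<close>, so
  \<open>cos u\<close> is at most \<open>cos 1 < 1\<close> there.
\<close>

lemma cos_density_integral_pos:
  assumes "0 < p" "p < 2"
  shows "0 < integral\<^sup>L lborel (cos_density p 1)"
proof -
  let ?c = "2 powr (- 1 - p) * (1 - cos 1)"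
  have c1: "0 < 1 - cos (1::real)" using cos_monotone_0_pi[of 0 1] pi_gt3 by simp
  have "?c = (\<integral>u. ?c * indicator {1..2::real} u \<partial>lborel)" by simp
  also have "\<dots> \<le> integral\<^sup>L lborel (cos_density p 1)"
  proof (rule integral_mono)
    show "integrable lborel (\<lambda>u. ?c * indicator {1..2::real} u)"
      by (intro integrable_mult_right integrable_real_indicator) auto
    fix u :: real
    show "?c * indicator {1..2} u \<le> cos_density p 1 u"
    proof (cases "u \<in> {1..2}")
      case True
      have "2 powr (- 1 - p) \<le> u powr (- 1 - p)"
        using True assms by (intro powr_mono2') auto
      moreover have "cos u \<le> cos 1"
        using True pi_gt3 by (intro cos_monotone_0_pi_le) auto
      ultimately have "?c \<le> u powr (- 1 - p) * (1 - cos u)"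
        using c1 by (intro mult_mono) auto
      with True show ?thesis by (simp add: cos_density_def)
    qed (simp add: cos_density_nonneg)
  qed (rule cos_density_integrable_1[OF assms])
  finally show ?thesis using c1 by (smt (verit) mult_pos_pos powr_gt_zero)
qed

section \<open>Positivity of the increment kernel\<close>

text \<open>
  Twice the covariance of the increments of fractional Brownian motion with Hurst index \<open>p / 2\<close>
  over the intervals from \<open>a\<close> to \<open>b\<close> and from \<open>c\<close> to \<open>d\<close>.
\<close>

definition increment_kernel :: "real \<Rightarrow> real \<Rightarrow> real \<Rightarrow> real \<Rightarrow> real \<Rightarrow> real" where
  "increment_kernel p a b c d =
     \<bar>b - c\<bar> powr p + \<bar>a - d\<bar> powr p - \<bar>b - d\<bar> powr p - \<bar>a - c\<bar> powr p"

lemma increment_kernel_sym: "increment_kernel p a b c d = increment_kernel p c d a b"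
  by (simp add: increment_kernel_def abs_minus_commute)

text \<open>
  In the cosine representation the constants \<open>1\<close> cancel from the second difference, and the addition
  theorem turns the frequency \<open>u\<close> part into \<open>C i * C j + E i * E j\<close>, with \<open>C i\<close> and \<open>E i\<close> the increments of
  \<open>cos (y * u)\<close> and \<open>sin (y * u)\<close> over the \<open>i\<close>-th interval. The quadratic form is thus an integral of
  sums of two squares against a positive weight.
\<close>

lemma increment_kernel_nonneg_definite:
  fixes a b x :: "'i \<Rightarrow> real"
  assumes p: "0 < p" "p < 2" and "finite A"
  shows "0 \<le> (\<Sum>i\<in>A. \<Sum>j\<in>A. increment_kernel p (a i) (b i) (a j) (b j) * (x i * x j))"
proof -
  let ?K = "integral\<^sup>L lborel (cos_density p 1)"
  let ?D = "\<lambda>i j u. cos_density p (b i - a j) u + cos_density p (a i - b j) u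
                  - cos_density p (b i - b j) u - cos_density p (a i - a j) u"
  let ?S = "\<lambda>u. \<Sum>i\<in>A. \<Sum>j\<in>A. ?D i j u * (x i * x j)"
  let ?Q = "\<Sum>i\<in>A. \<Sum>j\<in>A. increment_kernel p (a i) (b i) (a j) (b j) * (x i * x j)"
  have "has_bochner_integral lborel ?S
          (\<Sum>i\<in>A. \<Sum>j\<in>A. (\<bar>b i - a j\<bar> powr p * ?K + \<bar>a i - b j\<bar> powr p * ?K
             - \<bar>b i - b j\<bar> powr p * ?K - \<bar>a i - a j\<bar> powr p * ?K) * (x i * x j))"
    by (intro has_bochner_integral_sum has_bochner_integral_mult_left has_bochner_integral_diff
          has_bochner_integral_add cos_density_integral p)
  moreover have "(\<Sum>i\<in>A. \<Sum>j\<in>A. (\<bar>b i - a j\<bar> powr p * ?K + \<bar>a i - b j\<bar> powr p * ?K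
             - \<bar>b i - b j\<bar> powr p * ?K - \<bar>a i - a j\<bar> powr p * ?K) * (x i * x j)) = ?K * ?Q"
    unfolding increment_kernel_def sum_distrib_left
    by (intro sum.cong refl) (simp add: algebra_simps)
  moreover have "0 \<le> ?S u" for u
  proof -
    \<comment> \<open>Increments of cosine and sine at frequency \<open>u\<close>: the two real coordinates of a Gram vector.\<close>
    let ?C = "\<lambda>i. cos (b i * u) - cos (a i * u)"
    let ?E = "\<lambda>i. sin (b i * u) - sin (a i * u)"
    let ?w = "indicator {0<..} u * u powr (- 1 - p) :: real"
    have "?D i j u = ?w * (?C i * ?C j + ?E i * ?E j)" for i j
      by (simp add: cos_density_def left_diff_distrib cos_diff algebra_simps)
    then have "?S u = (\<Sum>i\<in>A. \<Sum>j\<in>A. (?w * (?C i * ?C j + ?E i * ?E j)) * (x i * x j))"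
      by (simp only:)
    also have "\<dots> = (\<Sum>i\<in>A. \<Sum>j\<in>A. ?w * ((x i * ?C i) * (x j * ?C j)) + ?w * ((x i * ?E i) * (x j * ?E j)))"
      by (intro sum.cong refl) (simp add: algebra_simps)
    also have "\<dots> = ?w * (\<Sum>i\<in>A. \<Sum>j\<in>A. (x i * ?C i) * (x j * ?C j))
                  + ?w * (\<Sum>i\<in>A. \<Sum>j\<in>A. (x i * ?E i) * (x j * ?E j))"
      by (simp only: sum.distrib sum_distrib_left)
    also have "\<dots> = ?w * ((\<Sum>i\<in>A. x i * ?C i)\<^sup>2 + (\<Sum>i\<in>A. x i * ?E i)\<^sup>2)"
      by (simp only: power2_eq_square sum_product distrib_left)
    finally show ?thesis by simp
  qed
  ultimately have "0 \<le> ?K * ?Q"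
    using Bochner_Integration.integral_nonneg[of lborel ?S] by (simp add: has_bochner_integral_iff)
  then show ?thesis using cos_density_integral_pos[OF p] by (simp add: zero_le_mult_iff)
qed

lemma symmetric_sum_lower_triangle:
  fixes B :: "nat \<Rightarrow> nat \<Rightarrow> real"
  assumes "\<And>i j. B i j = B j i"
  shows "(\<Sum>i = 1..m. \<Sum>j = 1..m. B i j)
       = (\<Sum>i = 1..m. 2 * (\<Sum>j = 1..<i. B i j) + B i i)"
proof (induction m)
  case (Suc m)
  have "(\<Sum>i = 1..m. B i (Suc m)) = (\<Sum>j = 1..m. B (Suc m) j)"
    by (intro sum.cong refl assms)
  with Suc show ?case by (simp add: sum.distrib atLeastLessThanSuc_atLeastAtMost)
qed simp

section \<open>Memory weights on a nonuniform mesh\<close>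

text \<open>
  For \<open>b = \<tau>\<close> the integrand is singular at the right endpoint, but its antiderivative is continuous
  there, which suffices for the fundamental theorem of calculus.
\<close>

lemma integral_frac_kernel:
  assumes "0 < \<alpha>" "a \<le> b" "b \<le> \<tau>"
  shows "integral {a..b} (\<lambda>\<zeta>. frac_kernel \<alpha> (\<tau> - \<zeta>))
         = ((\<tau> - a) powr \<alpha> - (\<tau> - b) powr \<alpha>) / (\<alpha> * Gamma \<alpha>)"
proof -
  have Gamma: "Gamma \<alpha> \<noteq> 0" using Gamma_real_pos[OF assms(1)] by simp
  let ?F = "\<lambda>\<zeta>. - ((\<tau> - \<zeta>) powr \<alpha>) / (\<alpha> * Gamma \<alpha>)"
  have "((\<lambda>\<zeta>. frac_kernel \<alpha> (\<tau> - \<zeta>)) has_integral ?F b - ?F a) {a..b}"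
  proof (rule fundamental_theorem_of_calculus_interior)
    show "continuous_on {a..b} ?F"
      using assms Gamma
      by (intro continuous_on_divide continuous_on_minus continuous_on_powr' continuous_on_diff
            continuous_on_id continuous_on_const) auto
    fix x assume x: "x \<in> {a<..<b}"
    from assms Gamma x show "(?F has_vector_derivative frac_kernel \<alpha> (\<tau> - x)) (at x)"
      unfolding has_real_derivative_iff_has_vector_derivative[symmetric] frac_kernel_def
      by (auto intro!: derivative_eq_intros)
  qed (use assms in auto)
  then show ?thesis by (simp add: integral_unique diff_divide_distrib)
qed

lemma integral_powr_shift:
  fixes \<alpha> a c d :: real
  assumes "0 < \<alpha>" "a \<le> c" "c \<le> d"
  shows "((\<lambda>\<tau>. (\<tau> - a) powr \<alpha>) has_integral
          ((d - a) powr (1 + \<alpha>) - (c - a) powr (1 + \<alpha>)) / (1 + \<alpha>)) {c..d}"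
proof -
  let ?F = "\<lambda>\<tau>::real. (\<tau> - a) powr (1 + \<alpha>) / (1 + \<alpha>)"
  have "((\<lambda>\<tau>. (\<tau> - a) powr \<alpha>) has_integral ?F d - ?F c) {c..d}"
  proof (rule fundamental_theorem_of_calculus_interior[where f = ?F])
    show "continuous_on {c..d} ?F"
      using assms
      by (intro continuous_on_divide continuous_on_powr' continuous_on_diff continuous_on_id
            continuous_on_const) auto
    fix x assume x: "x \<in> {c<..<d}"
    show "(?F has_vector_derivative (x - a) powr \<alpha>) (at x)"
      unfolding has_real_derivative_iff_has_vector_derivative[symmetric]
      using assms x by (auto intro!: derivative_eq_intros)
  qed (use assms in auto)
  then show ?thesis by (simp add: diff_divide_distrib)
qed

text \<open>
  Integrating the kernel once in each variable gives a second difference of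
  \<open>x powr (1 + \<alpha>)\<close>. Since the two time intervals do not overlap, all four differences of their
  endpoints are nonnegative, and the absolute values in the increment kernel can be dropped.
\<close>

lemma frac_weight_offdiag:
  assumes "0 < \<alpha>" and "t (s - 1) < t s" "t s \<le> t (n - 1)" "t (n - 1) < t n"
  shows "time_step t n * (frac_weight \<alpha> t n s * time_step t s)
       = increment_kernel (1 + \<alpha>) (t (n - 1)) (t n) (t (s - 1)) (t s)
           / (Gamma \<alpha> * \<alpha> * (1 + \<alpha>))"
proof -
  let ?P = "\<lambda>x y. (x - y) powr (1 + \<alpha>)"
  have "integral {t (n - 1)..t n} (\<lambda>\<tau>. integral {t (s - 1)..min \<tau> (t s)} (\<lambda>\<zeta>. frac_kernel \<alpha> (\<tau> - \<zeta>)))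
     = integral {t (n - 1)..t n} (\<lambda>\<tau>. ((\<tau> - t (s - 1)) powr \<alpha> - (\<tau> - t s) powr \<alpha>) / (\<alpha> * Gamma \<alpha>))"
  proof (rule Henstock_Kurzweil_Integration.integral_cong)
    fix \<tau> assume "\<tau> \<in> {t (n - 1)..t n}"
    with assms have "min \<tau> (t s) = t s" "t s \<le> \<tau>" by auto
    with assms show "integral {t (s - 1)..min \<tau> (t s)} (\<lambda>\<zeta>. frac_kernel \<alpha> (\<tau> - \<zeta>))
        = ((\<tau> - t (s - 1)) powr \<alpha> - (\<tau> - t s) powr \<alpha>) / (\<alpha> * Gamma \<alpha>)"
      by (simp add: integral_frac_kernel)
  qed
  also have "\<dots> = ((?P (t n) (t (s - 1)) - ?P (t (n - 1)) (t (s - 1))) / (1 + \<alpha>)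
                 - (?P (t n) (t s) - ?P (t (n - 1)) (t s)) / (1 + \<alpha>)) / (\<alpha> * Gamma \<alpha>)"
    by (intro integral_unique has_integral_divide has_integral_diff integral_powr_shift)
       (use assms in auto)
  also have "\<dots> = increment_kernel (1 + \<alpha>) (t (n - 1)) (t n) (t (s - 1)) (t s)
                    / (Gamma \<alpha> * \<alpha> * (1 + \<alpha>))"
    using assms by (simp add: increment_kernel_def diff_divide_distrib add_divide_distrib mult_ac)
  finally show ?thesis
    using assms by (simp add: frac_weight_def time_step_def)
qed

text \<open>
  The truncation of the inner integral keeps only the triangle below the diagonal of the square, hence
  half of the symmetric kernel. Exactly this factor on the diagonal makes the causal quadratic form
  half of the full symmetric one.
\<close>

lemma frac_weight_diag:
  assumes "0 < \<alpha>" and "t (n - 1) < t n"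
  shows "time_step t n * (frac_weight \<alpha> t n n * time_step t n)
       = increment_kernel (1 + \<alpha>) (t (n - 1)) (t n) (t (n - 1)) (t n)
           / (Gamma \<alpha> * \<alpha> * (1 + \<alpha>)) / 2"
proof -
  have "integral {t (n - 1)..t n} (\<lambda>\<tau>. integral {t (n - 1)..min \<tau> (t n)} (\<lambda>\<zeta>. frac_kernel \<alpha> (\<tau> - \<zeta>)))
     = integral {t (n - 1)..t n} (\<lambda>\<tau>. (\<tau> - t (n - 1)) powr \<alpha> / (\<alpha> * Gamma \<alpha>))"
  proof (rule Henstock_Kurzweil_Integration.integral_cong)
    fix \<tau> assume "\<tau> \<in> {t (n - 1)..t n}"
    then show "integral {t (n - 1)..min \<tau> (t n)} (\<lambda>\<zeta>. frac_kernel \<alpha> (\<tau> - \<zeta>))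
        = (\<tau> - t (n - 1)) powr \<alpha> / (\<alpha> * Gamma \<alpha>)"
      using assms integral_frac_kernel[of \<alpha> "t (n - 1)" \<tau> \<tau>] by (simp add: min_def)
  qed
  also have "\<dots> = ((t n - t (n - 1)) powr (1 + \<alpha>) - (t (n - 1) - t (n - 1)) powr (1 + \<alpha>))
                    / (1 + \<alpha>) / (\<alpha> * Gamma \<alpha>)"
    by (intro integral_unique has_integral_divide integral_powr_shift) (use assms in auto)
  also have "\<dots> = increment_kernel (1 + \<alpha>) (t (n - 1)) (t n) (t (n - 1)) (t n)
                    / (Gamma \<alpha> * \<alpha> * (1 + \<alpha>)) / 2"
  proof -
    have half: "(x + x) / c / 2 = x / c" for x c :: real by simp
    have "increment_kernel (1 + \<alpha>) (t (n - 1)) (t n) (t (n - 1)) (t n)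
        = (t n - t (n - 1)) powr (1 + \<alpha>) + (t n - t (n - 1)) powr (1 + \<alpha>)"
      using assms by (simp add: increment_kernel_def)
    then show ?thesis by (simp only: half) (simp add: mult_ac)
  qed
  finally show ?thesis
    using assms by (simp add: frac_weight_def time_step_def)
qed

text \<open>
  The kernel of fractional integration is of positive type, and product integration on an arbitrary
  mesh preserves this: the causal double sum is a positive multiple of the full quadratic
  form of the increment kernel over the time intervals.
\<close>

lemma frac_weight_quadratic_form_nonneg:
  fixes g :: "nat \<Rightarrow> real"
  assumes \<alpha>: "0 < \<alpha>" "\<alpha> < 1"
    and t: "\<And>n. 1 \<le> n \<Longrightarrow> n \<le> m \<Longrightarrow> t (n - 1) < t n"
  shows "0 \<le> (\<Sum>n = 1..m. time_step t n * (\<Sum>s = 1..n. frac_weight \<alpha> t n s * time_step t s * g s) * g n)"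
proof -
  define c where "c = Gamma \<alpha> * \<alpha> * (1 + \<alpha>)"
  have c: "0 < c" unfolding c_def using \<alpha> Gamma_real_pos by simp
  define B where "B n s = increment_kernel (1 + \<alpha>) (t (n - 1)) (t n) (t (s - 1)) (t s) * (g n * g s)" for n s
  have mono: "t i \<le> t j" if "i \<le> j" "j \<le> m" for i j
    using that
  proof (induction j rule: dec_induct)
    case (step k)
    with t[of "Suc k"] show ?case by simp
  qed simp
  have row: "2 * c * (time_step t n * (\<Sum>s = 1..n. frac_weight \<alpha> t n s * time_step t s * g s) * g n)
        = 2 * (\<Sum>s = 1..<n. B n s) + B n n" if n: "n \<in> {1..m}" for n
  proof -
    have "{1..n} = insert n {1..<n}" using n by auto
    then have "time_step t n * (\<Sum>s = 1..n. frac_weight \<alpha> t n s * time_step t s * g s) * g n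
      = (time_step t n * (frac_weight \<alpha> t n n * time_step t n)) * (g n * g n)
        + (\<Sum>s = 1..<n. (time_step t n * (frac_weight \<alpha> t n s * time_step t s)) * (g n * g s))"
      by (simp add: algebra_simps sum_distrib_left sum_distrib_right)
    also have "(\<Sum>s = 1..<n. (time_step t n * (frac_weight \<alpha> t n s * time_step t s)) * (g n * g s))
      = (\<Sum>s = 1..<n. B n s / c)"
    proof (rule sum.cong)
      fix s assume s: "s \<in> {1..<n}"
      with n mono[of s "n - 1"] t[of s] t[of n]
      have "t (s - 1) < t s" "t s \<le> t (n - 1)" "t (n - 1) < t n" by auto
      from frac_weight_offdiag[OF \<alpha>(1) this]
      show "(time_step t n * (frac_weight \<alpha> t n s * time_step t s)) * (g n * g s) = B n s / c"
        by (simp add: B_def c_def)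
    qed simp
    also have "(time_step t n * (frac_weight \<alpha> t n n * time_step t n)) * (g n * g n) = B n n / c / 2"
      using frac_weight_diag[OF \<alpha>(1) t[of n]] n by (simp add: B_def c_def)
    finally show ?thesis using c by (simp add: sum_divide_distrib[symmetric] field_simps)
  qed
  have "0 \<le> (\<Sum>n = 1..m. \<Sum>s = 1..m. B n s)"
    unfolding B_def by (rule increment_kernel_nonneg_definite) (use \<alpha> in auto)
  also have "\<dots> = (\<Sum>n = 1..m. 2 * (\<Sum>s = 1..<n. B n s) + B n n)"
    by (rule symmetric_sum_lower_triangle) (simp add: B_def increment_kernel_sym mult.commute)
  also have "\<dots> = 2 * c * (\<Sum>n = 1..m. time_step t n * (\<Sum>s = 1..n. frac_weight \<alpha> t n s * time_step t s * g s) * g n)"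
    by (subst sum_distrib_left) (intro sum.cong refl row[symmetric])
  finally show ?thesis using c by (simp add: zero_le_mult_iff)
qed

section \<open>Discrete norm and summation by parts\<close>

lemma grid_norm_L2_set: "0 \<le> h \<Longrightarrow> grid_norm h J w = sqrt h * L2_set w {1..J - 1}"
  by (simp add: grid_norm_def L2_set_def real_sqrt_mult)

lemma grid_norm_nonneg: "0 \<le> h \<Longrightarrow> 0 \<le> grid_norm h J w"
  by (simp add: grid_norm_L2_set)

lemma grid_norm_sq: "0 \<le> h \<Longrightarrow> (grid_norm h J w)\<^sup>2 = h * (\<Sum>j = 1..J - 1. (w j)\<^sup>2)"
  by (simp add: grid_norm_def sum_nonneg)

lemma grid_norm_Cauchy_Schwarz:
  assumes "0 \<le> h"
  shows "h * (\<Sum>j = 1..J - 1. v j * w j) \<le> grid_norm h J v * grid_norm h J w"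
proof -
  have "(\<Sum>j = 1..J - 1. v j * w j) \<le> (\<Sum>j = 1..J - 1. \<bar>v j\<bar> * \<bar>w j\<bar>)"
    by (intro sum_mono) (simp flip: abs_mult)
  also have "\<dots> \<le> L2_set v {1..J - 1} * L2_set w {1..J - 1}"
    by (rule L2_set_mult_ineq)
  finally have "h * (\<Sum>j = 1..J - 1. v j * w j) \<le> h * (L2_set v {1..J - 1} * L2_set w {1..J - 1})"
    using assms by (intro mult_left_mono)
  also have "\<dots> = (sqrt h * sqrt h) * (L2_set v {1..J - 1} * L2_set w {1..J - 1})"
    using assms by simp
  also have "\<dots> = grid_norm h J v * grid_norm h J w"
    using assms by (simp only: grid_norm_L2_set mult_ac)
  finally show ?thesis .
qed

lemma grid_norm_average:
  assumes "0 \<le> h"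
  shows "grid_norm h J (\<lambda>j. (v j + w j) / 2) \<le> max (grid_norm h J v) (grid_norm h J w)"
proof -
  have "L2_set (\<lambda>j. (v j + w j) / 2) {1..J - 1} \<le> L2_set (\<lambda>j. v j / 2) {1..J - 1} + L2_set (\<lambda>j. w j / 2) {1..J - 1}"
    using L2_set_triangle_ineq[of "\<lambda>j. v j / 2" "\<lambda>j. w j / 2"] by (simp add: add_divide_distrib)
  also have "\<dots> = (L2_set v {1..J - 1} + L2_set w {1..J - 1}) / 2"
    using L2_set_left_distrib[of "1/2" v "{1..J - 1}"] L2_set_left_distrib[of "1/2" w "{1..J - 1}"] by simp
  finally have "grid_norm h J (\<lambda>j. (v j + w j) / 2) \<le> sqrt h * ((L2_set v {1..J - 1} + L2_set w {1..J - 1}) / 2)"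
    using assms by (simp only: grid_norm_L2_set) (intro mult_left_mono, auto)
  also have "\<dots> = (grid_norm h J v + grid_norm h J w) / 2"
    using assms by (simp add: grid_norm_L2_set algebra_simps)
  finally show ?thesis by (auto simp: max_def)
qed

text \<open>
  The three-point average makes the discrete convection term conservative: \<open>6 * h\<close> times the
  summand at \<open>j\<close> is the difference between \<open>j\<close> and \<open>j - 1\<close> of the flux
  \<open>V j * V (j + 1) * (V j + V (j + 1))\<close>.
\<close>

lemma convection_sum_telescopes:
  fixes V :: "nat \<Rightarrow> real"
  shows "(\<Sum>j = 1..m. nabla V j * Delta_x h V j * V j)
       = (V m * V (Suc m) * (V m + V (Suc m)) - V 0 * V 1 * (V 0 + V 1)) / (6 * h)"
proof (cases "h = 0")
  case False
  then show ?thesis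
    by (induction m) (simp_all add: nabla_def Delta_x_def field_simps)
qed (simp add: Delta_x_def)

lemma convection_orthogonal:
  assumes "V 0 = 0" "V J = 0"
  shows "(\<Sum>j = 1..J - 1. nabla V j * Delta_x h V j * V j) = 0"
proof (cases J)
  case (Suc m)
  with assms show ?thesis using convection_sum_telescopes[of V h m] by simp
qed simp

lemma sum_second_difference_by_parts:
  fixes W V :: "nat \<Rightarrow> real"
  shows "(\<Sum>j = 1..m. (W (j + 1) - 2 * W j + W (j - 1)) * V j)
       = (W (Suc m) - W m) * V (Suc m) - (W 1 - W 0) * V 0
         - (\<Sum>j\<le>m. (W (Suc j) - W j) * (V (Suc j) - V j))"
  by (induction m) (simp_all add: algebra_simps)

lemma delta_x2_summation_by_parts:
  assumes "V 0 = 0" "V J = 0"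
  shows "(\<Sum>j = 1..J - 1. delta_x2 h W j * V j)
       = - (\<Sum>j<J. (W (Suc j) - W j) * (V (Suc j) - V j)) / h\<^sup>2"
proof (cases J)
  case 0
  then show ?thesis by simp
next
  case (Suc m)
  have "(\<Sum>j = 1..J - 1. delta_x2 h W j * V j)
      = (\<Sum>j = 1..m. (W (j + 1) - 2 * W j + W (j - 1)) * V j) / h\<^sup>2"
    using Suc by (simp add: delta_x2_def sum_divide_distrib)
  then show ?thesis
    unfolding sum_second_difference_by_parts using assms Suc by (simp add: lessThan_Suc_atMost)
qed

text \<open>
  Summation by parts moves one spatial difference to the test function. Exchanging the sums then
  leaves, for every spatial cell, the quadratic form of the memory weights applied to the
  differences across that cell.
\<close>

lemma memory_term_dissipative:
  assumes \<alpha>: "0 < \<alpha>" "\<alpha> < 1"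
    and t: "\<And>n. 1 \<le> n \<Longrightarrow> n \<le> m \<Longrightarrow> t (n - 1) < t n"
    and V: "\<And>n. 1 \<le> n \<Longrightarrow> n \<le> m \<Longrightarrow> V n 0 = 0 \<and> V n J = 0"
  shows "(\<Sum>n = 1..m. time_step t n *
            (\<Sum>j = 1..J - 1. (\<Sum>s = 1..n. frac_weight \<alpha> t n s * time_step t s * delta_x2 h (V s) j) * V n j)) \<le> 0"
proof -
  let ?w = "\<lambda>n s. frac_weight \<alpha> t n s * time_step t s"
  let ?g = "\<lambda>j n. V n (Suc j) - V n j"
  let ?q = "\<lambda>j n. time_step t n * (\<Sum>s = 1..n. ?w n s * ?g j s) * ?g j n"
  have "time_step t n * (\<Sum>j = 1..J - 1. (\<Sum>s = 1..n. ?w n s * delta_x2 h (V s) j) * V n j)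
      = - (\<Sum>j<J. ?q j n) / h\<^sup>2" if "n \<in> {1..m}" for n
  proof -
    have "(\<Sum>j = 1..J - 1. (\<Sum>s = 1..n. ?w n s * delta_x2 h (V s) j) * V n j)
        = (\<Sum>s = 1..n. ?w n s * (\<Sum>j = 1..J - 1. delta_x2 h (V s) j * V n j))"
      unfolding sum_distrib_left sum_distrib_right
      by (subst sum.swap) (simp add: mult_ac)
    also have "\<dots> = (\<Sum>s = 1..n. ?w n s * (- (\<Sum>j<J. ?g j s * ?g j n) / h\<^sup>2))"
      by (intro sum.cong refl, subst delta_x2_summation_by_parts) (use V[of n] that in auto)
    also have "\<dots> = - (\<Sum>s = 1..n. \<Sum>j<J. ?w n s * (?g j s * ?g j n)) / h\<^sup>2"
      by (simp add: sum_distrib_left sum_divide_distrib sum_negf)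
    also have "\<dots> = - (\<Sum>j<J. (\<Sum>s = 1..n. ?w n s * ?g j s) * ?g j n) / h\<^sup>2"
      by (subst sum.swap) (simp add: sum_distrib_right mult.assoc)
    finally show ?thesis by (simp only: mult.assoc sum_distrib_left[symmetric]) simp
  qed
  then have "(\<Sum>n = 1..m. time_step t n *
            (\<Sum>j = 1..J - 1. (\<Sum>s = 1..n. ?w n s * delta_x2 h (V s) j) * V n j))
        = (\<Sum>n = 1..m. - (\<Sum>j<J. ?q j n) / h\<^sup>2)"
    by (intro sum.cong) simp_all
  also have "\<dots> = - (\<Sum>j<J. \<Sum>n = 1..m. ?q j n) / h\<^sup>2"
    by (subst sum.swap) (simp add: sum_negf sum_divide_distrib)
  also have "\<dots> \<le> 0"
  proof -
    have "0 \<le> (\<Sum>j<J. \<Sum>n = 1..m. ?q j n)"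
      by (intro sum_nonneg frac_weight_quadratic_form_nonneg \<alpha> t)
    then show ?thesis by (simp add: divide_nonpos_nonneg)
  qed
  finally show ?thesis .
qed

section \<open>Energy estimate for the scheme\<close>

text \<open>
  The time level at which the scheme evaluates convection and memory: backward Euler in the first
  step, the midpoint afterwards. Testing with this same quantity is what makes both terms
  sign-controlled.
\<close>

definition test_level :: "(nat \<Rightarrow> nat \<Rightarrow> real) \<Rightarrow> nat \<Rightarrow> nat \<Rightarrow> real" where
  "test_level U n j = (if n = 1 then U 1 j else half_level (\<lambda>m. U m j) n)"

lemma delta_x2_half_level:
  "delta_x2 h (\<lambda>j. half_level (\<lambda>m. U m j) s) j = half_level (\<lambda>m. delta_x2 h (U m) j) s"
  by (simp add: delta_x2_def half_level_def diff_divide_distrib add_divide_distrib algebra_simps)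

lemma frac_integral_test_level:
  assumes "1 \<le> n"
  shows "frac_integral \<alpha> t (\<lambda>m. delta_x2 h (U m) j) n
       = (\<Sum>s = 1..n. frac_weight \<alpha> t n s * time_step t s * delta_x2 h (test_level U s) j)"
proof -
  have "test_level U 1 = U 1" by (auto simp: test_level_def)
  moreover have "test_level U s = (\<lambda>j. half_level (\<lambda>m. U m j) s)" if "s \<in> {2..n}" for s
    using that by (auto simp: test_level_def)
  moreover have "{1..n} = insert 1 {2..n}" using assms by auto
  ultimately show ?thesis
    by (simp add: frac_integral_def delta_x2_half_level mult_ac)
qed

text \<open>
  In the first step the difference of the two sides is half of \<open>(U 1 j - U 0 j)\<^sup>2\<close>; in every
  later step the midpoint gives equality.
\<close>

lemma increment_times_test_level:
  "((U n j)\<^sup>2 - (U (n - 1) j)\<^sup>2) / 2 \<le> (U n j - U (n - 1) j) * test_level U n j"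
proof (cases "n = 1")
  case True
  have "((U 1 j)\<^sup>2 - (U 0 j)\<^sup>2) / 2 + (U 1 j - U 0 j)\<^sup>2 / 2 = (U 1 j - U 0 j) * U 1 j"
    by (simp add: power2_eq_square field_simps)
  moreover have "0 \<le> (U 1 j - U 0 j)\<^sup>2 / 2" by simp
  ultimately have "((U 1 j)\<^sup>2 - (U 0 j)\<^sup>2) / 2 \<le> (U 1 j - U 0 j) * U 1 j" by linarith
  with True show ?thesis by (simp add: test_level_def)
next
  case False
  then show ?thesis by (simp add: test_level_def half_level_def power2_eq_square algebra_simps)
qed

text \<open>
  An energy inequality is quadratic in the solution, while the desired bound is linear. Let \<open>M\<close> be
  the largest of \<open>a 0, \<dots>, a n\<close>, attained at \<open>m\<close>. In the inequality at \<open>m\<close>, bound one factor \<open>a 0\<close>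
  and every \<open>b l\<close> by \<open>M\<close>; both sides then have a factor \<open>M\<close>, which cancels.
\<close>

lemma linear_bound_of_energy_inequality:
  fixes a b c :: "nat \<Rightarrow> real"
  assumes energy: "\<And>m. 1 \<le> m \<Longrightarrow> m \<le> n \<Longrightarrow> (a m)\<^sup>2 \<le> (a 0)\<^sup>2 + 2 * (\<Sum>l = 1..m. c l * b l)"
    and b: "\<And>l. 1 \<le> l \<Longrightarrow> l \<le> n \<Longrightarrow> b l \<le> max (a l) (a (l - 1))"
    and c: "\<And>l. 1 \<le> l \<Longrightarrow> l \<le> n \<Longrightarrow> 0 \<le> c l"
    and a: "\<And>l. 0 \<le> a l"
  shows "a n \<le> a 0 + 2 * (\<Sum>l = 1..n. c l)"
proof -
  define M where "M = Max (a ` {0..n})"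
  have le: "a l \<le> M" if "l \<le> n" for l
    unfolding M_def using that by (intro Max_ge) auto
  have "M \<in> a ` {0..n}" unfolding M_def by (intro Max_in) auto
  then obtain m where m: "m \<le> n" "M = a m" by auto
  have S: "0 \<le> (\<Sum>l = 1..n. c l)" by (intro sum_nonneg) (use c in auto)
  have "M \<le> a 0 + 2 * (\<Sum>l = 1..n. c l)"
  proof (cases "m = 0 \<or> M = 0")
    case True
    then show ?thesis using m S a[of 0] by auto
  next
    case False
    with m a[of m] have M: "0 < M" "1 \<le> m" by auto
    have "(\<Sum>l = 1..m. c l * b l) \<le> (\<Sum>l = 1..m. c l * M)"
    proof (intro sum_mono mult_left_mono)
      fix l assume l: "l \<in> {1..m}"
      have "b l \<le> max (a l) (a (l - 1))" using b[of l] l m by auto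
      also have "\<dots> \<le> M" using le[of l] le[of "l - 1"] l m by auto
      finally show "b l \<le> M" .
      show "0 \<le> c l" using c[of l] l m by auto
    qed
    also have "\<dots> \<le> (\<Sum>l = 1..n. c l * M)"
      by (intro sum_mono2) (use m M c in auto)
    also have "\<dots> = (\<Sum>l = 1..n. c l) * M" by (simp add: sum_distrib_right)
    finally have 1: "(\<Sum>l = 1..m. c l * b l) \<le> (\<Sum>l = 1..n. c l) * M" .
    have "(a 0)\<^sup>2 \<le> a 0 * M"
      using le[of 0] a[of 0] by (simp add: power2_eq_square mult_left_mono)
    with 1 energy[OF M(2) m(1)] have "M * M \<le> (a 0 + 2 * (\<Sum>l = 1..n. c l)) * M"
      by (simp add: m(2) power2_eq_square algebra_simps)
    then show ?thesis using M by simp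
  qed
  with le[of n] show ?thesis by simp
qed

theorem theorem4p2:
  fixes L T \<alpha> h :: real
    and u0 :: "real \<Rightarrow> real"
    and J N :: nat
    and t :: "nat \<Rightarrow> real"
    and U f :: "nat \<Rightarrow> nat \<Rightarrow> real"
  assumes "L > 0" and "T > 0" and "0 < \<alpha>" and "\<alpha> < 1"
    and "J \<ge> 1" and "N \<ge> 1"
    and h: "h = L / real J"
    and t_0: "t 0 = 0" and t_N: "t N = T"
    and t_less: "\<And>n. 1 \<le> n \<Longrightarrow> n \<le> N \<Longrightarrow> t (n - 1) < t n"
    and scheme_1: "\<And>j. 1 \<le> j \<Longrightarrow> j \<le> J - 1 \<Longrightarrow>
          delta_t t (\<lambda>m. U m j) 1 + nabla (U 1) j * Delta_x h (U 1) j
          = frac_integral \<alpha> t (\<lambda>m. delta_x2 h (U m) j) 1 + f 1 j"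
    and scheme_n: "\<And>n j. 2 \<le> n \<Longrightarrow> n \<le> N \<Longrightarrow> 1 \<le> j \<Longrightarrow> j \<le> J - 1 \<Longrightarrow>
          delta_t t (\<lambda>m. U m j) n
            + nabla (\<lambda>i. half_level (\<lambda>m. U m i) n) j * Delta_x h (\<lambda>i. half_level (\<lambda>m. U m i) n) j
          = frac_integral \<alpha> t (\<lambda>m. delta_x2 h (U m) j) n + f n j"
    and initial: "\<And>j. 1 \<le> j \<Longrightarrow> j \<le> J - 1 \<Longrightarrow> U 0 j = u0 (real j * h)"
    and boundary: "\<And>n. 1 \<le> n \<Longrightarrow> n \<le> N \<Longrightarrow> U n 0 = 0 \<and> U n J = 0"
  shows "\<forall>n. 1 \<le> n \<and> n \<le> N \<longrightarrow>
           grid_norm h J (U n) \<le> grid_norm h J (U 0)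
             + 2 * (\<Sum>l = 1..n. time_step t l * grid_norm h J (f l))"
proof (intro allI impI)
  fix n assume n: "1 \<le> n \<and> n \<le> N"
  have h0: "0 < h" using \<open>L > 0\<close> \<open>J \<ge> 1\<close> h by simp
  have k0: "0 < time_step t l" if "1 \<le> l" "l \<le> N" for l
    using t_less[OF that] by (simp add: time_step_def)
  let ?V = "test_level U"
  let ?memory = "\<lambda>l. \<Sum>j = 1..J - 1.
      (\<Sum>s = 1..l. frac_weight \<alpha> t l s * time_step t s * delta_x2 h (?V s) j) * ?V l j"
  let ?E = "\<lambda>l. \<Sum>j = 1..J - 1. (U l j)\<^sup>2"
  \<comment> \<open>Boundary values are prescribed from level \<open>1\<close> on; the first test level does not involve \<open>U 0\<close>
    and the later midpoints use only levels at least \<open>1\<close>.\<close>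
  have V_boundary: "?V l 0 = 0 \<and> ?V l J = 0" if "1 \<le> l" "l \<le> N" for l
    using boundary[of l] boundary[of "l - 1"] that by (auto simp: test_level_def half_level_def)
  have scheme: "delta_t t (\<lambda>m. U m j) l + nabla (?V l) j * Delta_x h (?V l) j
        = (\<Sum>s = 1..l. frac_weight \<alpha> t l s * time_step t s * delta_x2 h (?V s) j) + f l j"
    if "1 \<le> l" "l \<le> N" "j \<in> {1..J - 1}" for l j
  proof (cases "l = 1")
    case True
    have "?V 1 = U 1" by (auto simp: test_level_def)
    with scheme_1[of j] True that show ?thesis
      by (simp only: frac_integral_test_level) simp
  next
    case False
    then have "?V l = (\<lambda>j. half_level (\<lambda>m. U m j) l)" by (auto simp: test_level_def)
    with scheme_n[of l j] False that show ?thesis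
      by (simp add: frac_integral_test_level)
  qed
  \<comment> \<open>The scheme at step \<open>l\<close>, multiplied by \<open>time_step t l * ?V l j\<close> and summed over \<open>j\<close>. The memory
    term has no sign at a single step, so it is kept until the steps are added up.\<close>
  have step: "(?E l - ?E (l - 1)) / 2
      \<le> time_step t l * ?memory l + time_step t l * (\<Sum>j = 1..J - 1. f l j * ?V l j)"
    if l: "1 \<le> l" "l \<le> N" for l
  proof -
    let ?k = "time_step t l"
    have "(?E l - ?E (l - 1)) / 2 = (\<Sum>j = 1..J - 1. ((U l j)\<^sup>2 - (U (l - 1) j)\<^sup>2) / 2)"
      by (simp only: sum_subtractf sum_divide_distrib[symmetric])
    also have "\<dots> \<le> (\<Sum>j = 1..J - 1. (U l j - U (l - 1) j) * ?V l j)"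
      by (intro sum_mono increment_times_test_level)
    also have "\<dots> = (\<Sum>j = 1..J - 1. ?k * (delta_t t (\<lambda>m. U m j) l * ?V l j))"
      using k0[OF l] by (simp add: delta_t_def)
    also have "\<dots> = (\<Sum>j = 1..J - 1. ?k *
          (((\<Sum>s = 1..l. frac_weight \<alpha> t l s * time_step t s * delta_x2 h (?V s) j) * ?V l j
            + f l j * ?V l j) - nabla (?V l) j * Delta_x h (?V l) j * ?V l j))"
    proof (intro sum.cong refl)
      fix j assume "j \<in> {1..J - 1}"
      from scheme[OF l this] have d: "delta_t t (\<lambda>m. U m j) l
        = (\<Sum>s = 1..l. frac_weight \<alpha> t l s * time_step t s * delta_x2 h (?V s) j) + f l j
          - nabla (?V l) j * Delta_x h (?V l) j" by linarith
      show "?k * (delta_t t (\<lambda>m. U m j) l * ?V l j) = ?k *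
          (((\<Sum>s = 1..l. frac_weight \<alpha> t l s * time_step t s * delta_x2 h (?V s) j) * ?V l j
            + f l j * ?V l j) - nabla (?V l) j * Delta_x h (?V l) j * ?V l j)"
        by (simp only: d left_diff_distrib distrib_right)
    qed
    also have "\<dots> = ?k * (?memory l + (\<Sum>j = 1..J - 1. f l j * ?V l j)
          - (\<Sum>j = 1..J - 1. nabla (?V l) j * Delta_x h (?V l) j * ?V l j))"
      by (simp only: sum_distrib_left[symmetric] sum.distrib sum_subtractf)
    finally show ?thesis
      using convection_orthogonal[of "?V l" J h] V_boundary[OF l] by (simp add: distrib_left)
  qed
  show "grid_norm h J (U n) \<le> grid_norm h J (U 0)
             + 2 * (\<Sum>l = 1..n. time_step t l * grid_norm h J (f l))"
  proof (rule linear_bound_of_energy_inequality[where b = "\<lambda>l. grid_norm h J (?V l)"])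
    fix m assume m: "1 \<le> m" "m \<le> n"
    have "(?E m - ?E 0) / 2 = (\<Sum>l = 1..m. (?E l - ?E (l - 1)) / 2)"
      using sum_telescope''[of 0 m ?E] by (simp add: sum_divide_distrib[symmetric])
    also have "\<dots> \<le> (\<Sum>l = 1..m. time_step t l * ?memory l + time_step t l * (\<Sum>j = 1..J - 1. f l j * ?V l j))"
      using m n by (intro sum_mono step) auto
    also have "\<dots> \<le> (\<Sum>l = 1..m. time_step t l * (\<Sum>j = 1..J - 1. f l j * ?V l j))"
      using memory_term_dissipative[OF \<open>0 < \<alpha>\<close> \<open>\<alpha> < 1\<close>, of m t ?V J h] t_less V_boundary m n
      by (simp add: sum.distrib)
    finally have "h * ((?E m - ?E 0) / 2) \<le> h * (\<Sum>l = 1..m. time_step t l * (\<Sum>j = 1..J - 1. f l j * ?V l j))"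
      using h0 by (intro mult_left_mono) auto
    also have "\<dots> = (\<Sum>l = 1..m. time_step t l * (h * (\<Sum>j = 1..J - 1. f l j * ?V l j)))"
      by (simp add: sum_distrib_left mult_ac)
    also have "\<dots> \<le> (\<Sum>l = 1..m. time_step t l * (grid_norm h J (f l) * grid_norm h J (?V l)))"
      using h0 k0 m n
      by (intro sum_mono mult_left_mono grid_norm_Cauchy_Schwarz) (auto intro: less_imp_le)
    finally show "(grid_norm h J (U m))\<^sup>2 \<le> (grid_norm h J (U 0))\<^sup>2
        + 2 * (\<Sum>l = 1..m. time_step t l * grid_norm h J (f l) * grid_norm h J (?V l))"
      using h0 by (simp add: grid_norm_sq algebra_simps)
  next
    fix l assume "1 \<le> l" "l \<le> n"
    then show "grid_norm h J (?V l) \<le> max (grid_norm h J (U l)) (grid_norm h J (U (l - 1)))"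
    proof (cases "l = 1")
      case True
      then have "?V l = U 1" by (auto simp: test_level_def)
      with True show ?thesis by simp
    next
      case False
      then have "?V l = (\<lambda>j. (U l j + U (l - 1) j) / 2)" by (auto simp: test_level_def half_level_def)
      then show ?thesis using grid_norm_average[of h J "U l" "U (l - 1)"] h0 by simp
    qed
  next
    fix l assume "1 \<le> l" "l \<le> n"
    then show "0 \<le> time_step t l * grid_norm h J (f l)"
      using k0[of l] n h0 by (auto intro!: mult_nonneg_nonneg grid_norm_nonneg)
  next
    show "0 \<le> grid_norm h J (U l)" for l using h0 by (simp add: grid_norm_nonneg)
  qed
qed

end
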